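(* (Cassini's identity.) For every integer $n\ge 1$, $$BP_{n-1}\,BP_{n+1}-BP_n^2=12\,(-1)^n\,(j+ij)$$ and $$BPL_{n-1}\,BPL_{n+1}-BPL_n^2=8\cdot 12\,(-1)^{n+1}\,(j+ij).$$
   Context: The bicomplex numbers $\mathbb{C}_2=\{q_1+iq_2+jq_3+ijq_4 : q_1,q_2,q_3,q_4\in\mathbb{R}\}$ form the commutative associative real algebra with basis $1,i,j,ij$ and multiplication determined by $i^2=-1$, $j^2=-1$, $ij=ji$ (so $(ij)^2=1$). The Pell numbers are given by $P_0=0$, $P_1=1$, $P_n=2P_{n-1}+P_{n-2}$ and the Pell-Lucas numbers by $Q_0=2$, $Q_1=2$, $Q_n=2Q_{n-1}+Q_{n-2}$. The bicomplex Pell and bicomplex Pell-Lucas numbers are $BP_n=P_n+iP_{n+1}+jP_{n+2}+ijP_{n+3}$ and $BPL_n=Q_n+iQ_{n+1}+jQ_{n+2}+ijQ_{n+3}$. *)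

theory Defs
  imports Complex_Main
begin

text \<open>
  The element with coordinates (q1, q2, q3, q4) is q1 + i q2 + j q3 + ij q4;
  lemma \<open>bicomplex_eq_basis\<close> below confirms this reading.
\<close>

datatype bicomplex = Bicomplex (bc1: real) (bc2: real) (bc3: real) (bc4: real)

lemma bicomplex_eq_iff:
  "x = y \<longleftrightarrow> bc1 x = bc1 y \<and> bc2 x = bc2 y \<and> bc3 x = bc3 y \<and> bc4 x = bc4 y"
  by (auto intro: bicomplex.expand)

text \<open>
  Multiplication is the bilinear extension of \<open>i\<^sup>2 = j\<^sup>2 = -1\<close>, \<open>ij = ji\<close>
  (hence \<open>(ij)\<^sup>2 = 1\<close>).
\<close>

instantiation bicomplex :: "{comm_ring_1, real_algebra_1}"
begin

definition zero_bicomplex :: bicomplex where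
  "0 = Bicomplex 0 0 0 0"

definition one_bicomplex :: bicomplex where
  "1 = Bicomplex 1 0 0 0"

definition plus_bicomplex :: "bicomplex \<Rightarrow> bicomplex \<Rightarrow> bicomplex" where
  "x + y = Bicomplex (bc1 x + bc1 y) (bc2 x + bc2 y) (bc3 x + bc3 y) (bc4 x + bc4 y)"

definition uminus_bicomplex :: "bicomplex \<Rightarrow> bicomplex" where
  "- x = Bicomplex (- bc1 x) (- bc2 x) (- bc3 x) (- bc4 x)"

definition minus_bicomplex :: "bicomplex \<Rightarrow> bicomplex \<Rightarrow> bicomplex" where
  "x - y = Bicomplex (bc1 x - bc1 y) (bc2 x - bc2 y) (bc3 x - bc3 y) (bc4 x - bc4 y)"

definition scaleR_bicomplex :: "real \<Rightarrow> bicomplex \<Rightarrow> bicomplex" where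
  "r *\<^sub>R x = Bicomplex (r * bc1 x) (r * bc2 x) (r * bc3 x) (r * bc4 x)"

definition times_bicomplex :: "bicomplex \<Rightarrow> bicomplex \<Rightarrow> bicomplex" where
  "x * y = Bicomplex
     (bc1 x * bc1 y - bc2 x * bc2 y - bc3 x * bc3 y + bc4 x * bc4 y)
     (bc1 x * bc2 y + bc2 x * bc1 y - bc3 x * bc4 y - bc4 x * bc3 y)
     (bc1 x * bc3 y + bc3 x * bc1 y - bc2 x * bc4 y - bc4 x * bc2 y)
     (bc1 x * bc4 y + bc4 x * bc1 y + bc2 x * bc3 y + bc3 x * bc2 y)"

instance
  by standard
    (simp_all add: bicomplex_eq_iff zero_bicomplex_def one_bicomplex_def plus_bicomplex_def
      uminus_bicomplex_def minus_bicomplex_def scaleR_bicomplex_def times_bicomplex_def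
      algebra_simps)

end

definition bc_i :: bicomplex where
  "bc_i = Bicomplex 0 1 0 0"

definition bc_j :: bicomplex where
  "bc_j = Bicomplex 0 0 1 0"

lemma bc_i_squared: "bc_i\<^sup>2 = -1"
  by (simp add: bicomplex_eq_iff power2_eq_square bc_i_def times_bicomplex_def
      uminus_bicomplex_def one_bicomplex_def)

lemma bc_j_squared: "bc_j\<^sup>2 = -1"
  by (simp add: bicomplex_eq_iff power2_eq_square bc_j_def times_bicomplex_def
      uminus_bicomplex_def one_bicomplex_def)

lemma bicomplex_eq_basis:
  "Bicomplex q1 q2 q3 q4 =
     of_real q1 + bc_i * of_real q2 + bc_j * of_real q3 + bc_i * bc_j * of_real q4"
  by (simp add: bicomplex_eq_iff of_real_def bc_i_def bc_j_def times_bicomplex_def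
      plus_bicomplex_def scaleR_bicomplex_def one_bicomplex_def)

fun pell :: "nat \<Rightarrow> nat" where
  "pell 0 = 0"
| "pell (Suc 0) = 1"
| "pell (Suc (Suc n)) = 2 * pell (Suc n) + pell n"

fun pell_lucas :: "nat \<Rightarrow> nat" where
  "pell_lucas 0 = 2"
| "pell_lucas (Suc 0) = 2"
| "pell_lucas (Suc (Suc n)) = 2 * pell_lucas (Suc n) + pell_lucas n"

definition BP :: "nat \<Rightarrow> bicomplex" where
  "BP n = of_nat (pell n) + bc_i * of_nat (pell (n + 1))
        + bc_j * of_nat (pell (n + 2)) + bc_i * bc_j * of_nat (pell (n + 3))"

definition BPL :: "nat \<Rightarrow> bicomplex" where
  "BPL n = of_nat (pell_lucas n) + bc_i * of_nat (pell_lucas (n + 1))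
         + bc_j * of_nat (pell_lucas (n + 2)) + bc_i * bc_j * of_nat (pell_lucas (n + 3))"

end

theory Submission
  imports Defs
begin

text \<open>
  The Cassini expression \<open>x\<^sub>n x\<^sub>n\<^sub>+\<^sub>2 - x\<^sub>n\<^sub>+\<^sub>1\<^sup>2\<close> is minus the determinant of
  the matrix with rows \<open>(x\<^sub>n\<^sub>+\<^sub>1, x\<^sub>n)\<close> and \<open>(x\<^sub>n\<^sub>+\<^sub>2, x\<^sub>n\<^sub>+\<^sub>1)\<close>. If
  \<open>x\<close> satisfies the Pell recurrence, passing from \<open>n\<close> to \<open>n + 1\<close> multiplies this matrix by
  one of determinant \<open>-1\<close>, so the expression only changes sign. This works in every commutative
  ring (\<open>cassini_of_pell_recurrence\<close>), and the bicomplex numbers form one. Their products need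
  therefore never be expanded for general \<open>n\<close>: \<open>BP\<close> and \<open>BPL\<close> inherit the recurrence from
  their coordinates by linearity, and what remains is the value at the first index, a
  computation with four integer coordinates (\<open>BP_cassini_initial\<close>, \<open>BPL_cassini_initial\<close>).
\<close>

text \<open>
  Replace \<open>x (n + 3)\<close> and one factor of \<open>(x (n + 2))\<^sup>2\<close> by means of the recurrence: the
  terms \<open>2 x (n + 1) x (n + 2)\<close> cancel, and minus the previous Cassini expression is left.
\<close>

lemma cassini_of_pell_recurrence:
  fixes x :: "nat \<Rightarrow> 'a :: comm_ring_1"
  assumes rec: "\<And>n. x (Suc (Suc n)) = 2 * x (Suc n) + x n"
  shows "x n * x (Suc (Suc n)) - (x (Suc n))\<^sup>2 = (-1) ^ n * (x 0 * x 2 - (x 1)\<^sup>2)"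
proof (induction n)
  case 0
  show ?case by (simp add: numeral_2_eq_2)
next
  case (Suc n)
  have "x (Suc n) * x (Suc (Suc (Suc n))) - (x (Suc (Suc n)))\<^sup>2
      = - (x n * x (Suc (Suc n)) - (x (Suc n))\<^sup>2)"
    unfolding rec by (simp add: power2_eq_square algebra_simps)
  with Suc.IH show ?case by simp
qed

lemma BP_rec: "BP (Suc (Suc n)) = 2 * BP (Suc n) + BP n"
  by (simp add: BP_def eval_nat_numeral algebra_simps)

lemma BPL_rec: "BPL (Suc (Suc n)) = 2 * BPL (Suc n) + BPL n"
  by (simp add: BPL_def eval_nat_numeral algebra_simps)

lemma BP_eq_Bicomplex: "BP n = Bicomplex (pell n) (pell (n + 1)) (pell (n + 2)) (pell (n + 3))"
  by (simp add: BP_def bicomplex_eq_basis)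

lemma BPL_eq_Bicomplex:
  "BPL n = Bicomplex (pell_lucas n) (pell_lucas (n + 1)) (pell_lucas (n + 2)) (pell_lucas (n + 3))"
  by (simp add: BPL_def bicomplex_eq_basis)

text \<open>
  Turns a real multiple of \<open>j + ij\<close> into coordinates, where the initial values are computed.
\<close>

lemma of_real_times_j_plus_ij: "of_real c * (bc_j + bc_i * bc_j) = Bicomplex 0 0 c c"
  unfolding bicomplex_eq_basis by (simp add: algebra_simps)

lemma BP_cassini_initial: "BP 0 * BP 2 - (BP 1)\<^sup>2 = - 12 * (bc_j + bc_i * bc_j)"
proof -
  have "BP 0 * BP 2 - (BP 1)\<^sup>2 = Bicomplex 0 0 (- 12) (- 12)"
    by (simp add: BP_eq_Bicomplex numeral_eq_Suc one_bicomplex_def times_bicomplex_def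
        minus_bicomplex_def)
  then show ?thesis
    using of_real_times_j_plus_ij[of "- 12"] by simp
qed

lemma BPL_cassini_initial: "BPL 0 * BPL 2 - (BPL 1)\<^sup>2 = 8 * 12 * (bc_j + bc_i * bc_j)"
proof -
  have "BPL 0 * BPL 2 - (BPL 1)\<^sup>2 = Bicomplex 0 0 96 96"
    by (simp add: BPL_eq_Bicomplex numeral_eq_Suc one_bicomplex_def times_bicomplex_def
        minus_bicomplex_def)
  then show ?thesis
    using of_real_times_j_plus_ij[of 96] by simp
qed

theorem theorem2p8:
  fixes n :: nat
  assumes "n \<ge> 1"
  shows "BP (n - 1) * BP (n + 1) - (BP n)\<^sup>2 = 12 * (-1) ^ n * (bc_j + bc_i * bc_j)
    \<and> BPL (n - 1) * BPL (n + 1) - (BPL n)\<^sup>2 = 8 * 12 * (-1) ^ (n + 1) * (bc_j + bc_i * bc_j)"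
proof -
  from assms obtain m where n: "n = Suc m" by (cases n) auto
  have "BP m * BP (Suc (Suc m)) - (BP (Suc m))\<^sup>2 = (-1) ^ m * (- 12 * (bc_j + bc_i * bc_j))"
    using cassini_of_pell_recurrence[of BP m, OF BP_rec] unfolding BP_cassini_initial .
  moreover have "BPL m * BPL (Suc (Suc m)) - (BPL (Suc m))\<^sup>2
      = (-1) ^ m * (8 * 12 * (bc_j + bc_i * bc_j))"
    using cassini_of_pell_recurrence[of BPL m, OF BPL_rec] unfolding BPL_cassini_initial .
  ultimately show ?thesis by (simp add: n algebra_simps)
qed

end
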